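(* For each $r\in\mathbb{N}=\{0,1,2,\ldots\}$, the sets $\mathcal{R}^r_{MS}$, $\mathcal{R}^r_{AS}$ and $\mathcal{R}^r_{ref}$ are open subsets of $\mathbb{C}$ and are symmetric with respect to the real axis (i.e. invariant under $z\mapsto\bar z$).
   Context: For $r\in\mathbb{N}$ (with $0\in\mathbb{N}$) and $z\in\mathbb{C}$ define $f_{r,z}\colon\mathbb{R}\to\mathbb{C}$ by $f_{r,z}(t)=\sum_{j=0}^{r+1}\frac{z^j}{j!}+\frac{t^{r+1}}{(r+1)!}z^{r+2}$. Let $\tau_1,\tau_2,\ldots$ be independent random variables, uniformly distributed on $[0,1]$, on a probability space $(\Omega,\Sigma,\mathbb{P})$, and fix $\eta\neq 0$. For $z\in\mathbb{C}$ put $v^r_k=v^r_k(z)=\eta\prod_{l=1}^k f_{r,z}(\tau_l)$, $k\in\mathbb{N}$. (This is the output of the randomized Taylor scheme with step-size $h>0$ applied to the test problem $y'=\lambda y$, $y(0)=\eta$, where $z=\lambda h$.) Define $\mathcal{R}^r_{MS}=\{z\in\mathbb{C}\colon v^r_k\to0 \text{ in } L^2(\Omega) \text{ as } k\to\infty\}$ (region of mean-square stability), $\mathcal{R}^r_{AS}=\{z\in\mathbb{C}\colon v^r_k\to0 \text{ almost surely as } k\to\infty\}$ (region of asymptotic stability), $\mathcal{R}^r_{ref}=\{z\in\mathbb{C}\colon |\sum_{j=0}^{r+2}\frac{z^j}{j!}|<1\}$ (reference set). *)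

theory Defs
  imports "HOL-Probability.Probability"
begin

text \<open>
  The stability function of one step of the randomized Taylor scheme
  for the test problem \<open>y' = \<lambda>y\<close>, where \<open>z = \<lambda>h\<close> and \<open>t\<close> is the random node.
\<close>
definition stab_fun :: "nat \<Rightarrow> complex \<Rightarrow> real \<Rightarrow> complex" where
  "stab_fun r z t =
     (\<Sum>j = 0..r + 1. z ^ j / fact j) + complex_of_real (t ^ (r + 1) / fact (r + 1)) * z ^ (r + 2)"

definition scheme :: "(nat \<Rightarrow> 'a \<Rightarrow> real) \<Rightarrow> complex \<Rightarrow> nat \<Rightarrow> complex \<Rightarrow> nat \<Rightarrow> 'a \<Rightarrow> complex" where
  "scheme \<tau> \<eta> r z k \<omega> = \<eta> * (\<Prod>l = 1..k. stab_fun r z (\<tau> l \<omega>))"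

definition square_integrable :: "'a measure \<Rightarrow> ('a \<Rightarrow> complex) \<Rightarrow> bool" where
  "square_integrable M X \<longleftrightarrow>
     X \<in> borel_measurable M \<and> integrable M (\<lambda>\<omega>. (norm (X \<omega>))\<^sup>2)"

text \<open>
  Square integrability is demanded explicitly because the Bochner integral of a
  non-integrable function is \<open>0\<close>.
\<close>
definition tendsto_L2 :: "'a measure \<Rightarrow> (nat \<Rightarrow> 'a \<Rightarrow> complex) \<Rightarrow> ('a \<Rightarrow> complex) \<Rightarrow> bool" where
  "tendsto_L2 M X Y \<longleftrightarrow>
     (\<forall>k. square_integrable M (X k)) \<and> square_integrable M Y \<and>
     (\<lambda>k. sqrt (\<integral>\<omega>. (norm (X k \<omega> - Y \<omega>))\<^sup>2 \<partial>M)) \<longlonglongrightarrow> 0"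

definition region_MS :: "'a measure \<Rightarrow> (nat \<Rightarrow> 'a \<Rightarrow> real) \<Rightarrow> complex \<Rightarrow> nat \<Rightarrow> complex set" where
  "region_MS M \<tau> \<eta> r = {z. tendsto_L2 M (scheme \<tau> \<eta> r z) (\<lambda>_. 0)}"

definition region_AS :: "'a measure \<Rightarrow> (nat \<Rightarrow> 'a \<Rightarrow> real) \<Rightarrow> complex \<Rightarrow> nat \<Rightarrow> complex set" where
  "region_AS M \<tau> \<eta> r = {z. AE \<omega> in M. (\<lambda>k. scheme \<tau> \<eta> r z k \<omega>) \<longlonglongrightarrow> 0}"

definition region_ref :: "nat \<Rightarrow> complex set" where
  "region_ref r = {z. norm (\<Sum>j = 0..r + 2. z ^ j / fact j) < 1}"

end

(*
  Let G s z be the s-th absolute moment of f_{r,z}(tau_1) for s > 0. By dominated convergence it is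
  continuous in z, and it is invariant under conjugation. By independence the s-th absolute moment of
  v_k is |eta|^s * (G s z)^k, so the region of mean-square stability is {G 2 < 1}.

  The region of asymptotic stability is the union of the open sets {G s < 1} over all s > 0. This
  replaces the criterion E ln |f_{r,z}(tau_1)| < 0 and so avoids the singularities of the logarithm.
  If G s z < 1, the s-th moments of v_k have a finite sum, hence v_k tends to 0 almost surely.
  Conversely, suppose that the products W_k of the factors |f_{r,z}(tau_l)| <= C tend to 0 almost
  surely. Stop W when it leaves the interval (1/K, b), where K = b * C. For b and N large the stopped
  product Y_N exceeds 1/K with probability q < 1/3 only, since this requires that W reaches b at some
  time or that W_N > 1/K. With s chosen such that K^s = 3/2 we get
  E Y_N^s <= q * 3/2 + (1 - q) * 2/3 < 1. But Y^s would be a submartingale starting at 1 if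
  G s z >= 1.
*)
theory Submission
  imports Defs
begin

section \<open>Products stopped on leaving an open interval\<close>

fun stopped_prod :: "real \<Rightarrow> real \<Rightarrow> (nat \<Rightarrow> real) \<Rightarrow> nat \<Rightarrow> real" where
  "stopped_prod a b x 0 = 1"
| "stopped_prod a b x (Suc k) =
     stopped_prod a b x k * (if stopped_prod a b x k \<in> {a<..<b} then x (Suc k) else 1)"

lemma stopped_prod_nonneg:
  assumes "\<And>l. 1 \<le> l \<Longrightarrow> 0 \<le> x l"
  shows "0 \<le> stopped_prod a b x k"
  using assms by (induction k) auto

text \<open>A factor enters only while the value is below \<open>b\<close>, so one factor of size at
  most \<open>C\<close> is all that can overshoot.\<close>

lemma stopped_prod_le:
  assumes "\<And>l. 1 \<le> l \<Longrightarrow> 0 \<le> x l" "\<And>l. 1 \<le> l \<Longrightarrow> x l \<le> C" "1 \<le> b" "1 \<le> C"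
  shows "stopped_prod a b x k \<le> b * C"
proof (induction k)
  case 0
  show ?case using assms mult_mono[of 1 b 1 C] by simp
next
  case (Suc k)
  show ?case
  proof (cases "stopped_prod a b x k \<in> {a<..<b}")
    case True
    have "stopped_prod a b x k * x (Suc k) \<le> b * C"
      using True assms by (intro mult_mono) auto
    then show ?thesis using True by simp
  next
    case False
    then show ?thesis using Suc.IH by auto
  qed
qed

text \<open>The alternatives are: still equal to the true product, frozen or about to freeze below,
  frozen or about to freeze above. In the last one \<open>j\<close> is the time of exit, when the
  true product itself has reached \<open>b\<close>.\<close>

lemma stopped_prod_cases:
  assumes "a < b"
  shows "stopped_prod a b x k = (\<Prod>l=1..k. x l) \<or> stopped_prod a b x k \<le> a \<or>
    (b \<le> stopped_prod a b x k \<and> (\<exists>j. b \<le> (\<Prod>l=1..j. x l)))"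
proof (induction k)
  case 0
  show ?case by simp
next
  case (Suc k)
  consider "stopped_prod a b x k \<in> {a<..<b}" | "stopped_prod a b x k \<le> a"
    | "b \<le> stopped_prod a b x k" by force
  then show ?case
  proof cases
    case 1
    then have "stopped_prod a b x k = (\<Prod>l=1..k. x l)" using Suc.IH by auto
    then show ?thesis using 1 by simp
  next
    case 2
    then show ?thesis by simp
  next
    case 3
    then have "\<exists>j. b \<le> (\<Prod>l=1..j. x l)" using Suc.IH assms by (metis leD order.strict_trans1)
    then show ?thesis using 3 by simp
  qed
qed

lemma stopped_prod_cong:
  assumes "\<And>l. l \<in> {1..k} \<Longrightarrow> x l = y l"
  shows "stopped_prod a b x k = stopped_prod a b y k"
  using assms by (induction k) auto

lemma measurable_stopped_prod:
  assumes "\<And>l. l \<in> {1..k} \<Longrightarrow> (\<lambda>\<omega>. X l \<omega>) \<in> borel_measurable M"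
  shows "(\<lambda>\<omega>. stopped_prod a b (\<lambda>l. X l \<omega>) k) \<in> borel_measurable M"
  using assms
proof (induction k)
  case 0
  show ?case by simp
next
  case (Suc k)
  have [measurable]: "(\<lambda>\<omega>. stopped_prod a b (\<lambda>l. X l \<omega>) k) \<in> borel_measurable M"
    "X (Suc k) \<in> borel_measurable M"
    using Suc by auto
  show ?case by simp
qed

section \<open>Almost sure decay forces some moment below 1\<close>

text \<open>Continuity of the measure from above, since the intersection of the events is a null
  set.\<close>

lemma (in prob_space) ex_prob_decseq_less:
  fixes A :: "nat \<Rightarrow> 'a set"
  assumes "\<And>n. A n \<in> events" "decseq A" "AE \<omega> in M. \<exists>n. \<omega> \<notin> A n" "0 < e"
  shows "\<exists>n. prob (A n) < e"
proof -
  have "(\<lambda>n. prob (A n)) \<longlonglongrightarrow> prob (\<Inter>n. A n)"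
    using assms by (intro finite_Lim_measure_decseq) auto
  moreover have "prob (\<Inter>n. A n) = 0"
    using assms by (subst prob_eq_0) auto
  ultimately have "\<forall>\<^sub>F n in sequentially. prob (A n) < e"
    using order_tendstoD(2)[of _ 0 sequentially e] assms by simp
  then show ?thesis by (auto simp: eventually_sequentially)
qed

text \<open>The submartingale property in integrated form: a running product gets an independent
  factor whose s-th moment is at least 1, and a frozen one does not change. Hence the moment cannot
  drop below its initial value 1.\<close>

lemma (in prob_space) expectation_stopped_prod_powr_ge_1:
  fixes X :: "nat \<Rightarrow> 'a \<Rightarrow> real"
  assumes indep: "indep_vars (\<lambda>_. borel) X {1..}"
    and nonneg: "\<And>l \<omega>. 1 \<le> l \<Longrightarrow> 0 \<le> X l \<omega>"
    and bdd: "\<And>l. 1 \<le> l \<Longrightarrow> AE \<omega> in M. X l \<omega> \<le> C"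
    and bC: "1 \<le> b" "1 \<le> C" and s: "0 < s"
    and ge: "\<And>l. 1 \<le> l \<Longrightarrow> 1 \<le> expectation (\<lambda>\<omega>. X l \<omega> powr s)"
  shows "1 \<le> expectation (\<lambda>\<omega>. stopped_prod a b (\<lambda>l. X l \<omega>) k powr s)"
proof (induction k)
  case 0
  show ?case by (simp add: prob_space)
next
  case (Suc k)
  have [measurable]: "X l \<in> borel_measurable M" if "1 \<le> l" for l
    using indep that by (auto simp: indep_vars_def)
  let ?Y = "\<lambda>\<omega>. stopped_prod a b (\<lambda>l. X l \<omega>) k"
  have Y_meas [measurable]: "?Y \<in> borel_measurable M"
    by (intro measurable_stopped_prod) auto
  have Y_nn: "0 \<le> ?Y \<omega>" for \<omega>
    by (intro stopped_prod_nonneg nonneg)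
  have "AE \<omega> in M. \<forall>l\<in>{1..}. X l \<omega> \<le> C"
    using bdd by (intro AE_ball_countable') auto
  then have "AE \<omega> in M. ?Y \<omega> powr s \<le> (b * C) powr s"
  proof eventually_elim
    case (elim \<omega>)
    show ?case
      using elim bC nonneg s by (intro powr_mono2 stopped_prod_le Y_nn) auto
  qed
  then have intY: "integrable M (\<lambda>\<omega>. ?Y \<omega> powr s)"
    by (intro integrable_const_bound[where B = "(b * C) powr s"]) auto
  have "AE \<omega> in M. X (Suc k) \<omega> powr s \<le> C powr s"
    using bdd[of "Suc k", simplified] by eventually_elim (use nonneg s in \<open>auto intro!: powr_mono2\<close>)
  then have intX: "integrable M (\<lambda>\<omega>. X (Suc k) \<omega> powr s)"
    by (intro integrable_const_bound[where B = "C powr s"]) auto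
  \<comment> \<open>\<open>V\<close> keeps the power of a running value and \<open>U\<close> that of
    a frozen one, so the s-th power of the next value is \<open>U (?Y \<omega>) + V (?Y \<omega>) *
    X (Suc k) \<omega> powr s\<close>.\<close>
  define V where "V y = (if y \<in> {a<..<b} then y powr s else 0)" for y :: real
  define U where "U y = (if y \<in> {a<..<b} then 0 else y powr s)" for y :: real
  have [measurable]: "V \<in> borel_measurable borel" "U \<in> borel_measurable borel"
    unfolding V_def[abs_def] U_def[abs_def] by measurable
  have UV: "U y + V y = y powr s" for y by (simp add: U_def V_def)
  have intU: "integrable M (\<lambda>\<omega>. U (?Y \<omega>))" and intV: "integrable M (\<lambda>\<omega>. V (?Y \<omega>))"
    by (rule Bochner_Integration.integrable_bound[OF intY]; auto simp: U_def V_def)+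
  \<comment> \<open>The value after k steps depends on the factors 1 to k alone, and is therefore
    independent of the next factor.\<close>
  have "indep_var borel ((\<lambda>x. V (stopped_prod a b x k)) \<circ> (\<lambda>\<omega>. restrict (\<lambda>i. X i \<omega>) {1..k}))
      borel ((\<lambda>x. x (Suc k) powr s) \<circ> (\<lambda>\<omega>. restrict (\<lambda>i. X i \<omega>) {Suc k}))"
    by (intro indep_var_compose[OF indep_var_restrict[OF indep]]
      measurable_compose[OF measurable_stopped_prod]) auto
  also have "(\<lambda>x. V (stopped_prod a b x k)) \<circ> (\<lambda>\<omega>. restrict (\<lambda>i. X i \<omega>) {1..k}) = (\<lambda>\<omega>. V (?Y \<omega>))"
    by (auto simp: fun_eq_iff intro!: arg_cong[where f = V] stopped_prod_cong)
  also have "(\<lambda>x. x (Suc k) powr s) \<circ> (\<lambda>\<omega>. restrict (\<lambda>i. X i \<omega>) {Suc k}) = (\<lambda>\<omega>. X (Suc k) \<omega> powr s)"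
    by (auto simp: fun_eq_iff)
  finally have ind: "indep_var borel (\<lambda>\<omega>. V (?Y \<omega>)) borel (\<lambda>\<omega>. X (Suc k) \<omega> powr s)" .
  have "expectation (\<lambda>\<omega>. ?Y \<omega> powr s) = expectation (\<lambda>\<omega>. U (?Y \<omega>)) + expectation (\<lambda>\<omega>. V (?Y \<omega>))"
    using intU intV by (simp flip: UV)
  also have "\<dots> \<le> expectation (\<lambda>\<omega>. U (?Y \<omega>)) +
      expectation (\<lambda>\<omega>. V (?Y \<omega>)) * expectation (\<lambda>\<omega>. X (Suc k) \<omega> powr s)"
  proof -
    have "0 \<le> expectation (\<lambda>\<omega>. V (?Y \<omega>))"
      by (intro integral_nonneg_AE) (auto simp: V_def)
    then show ?thesis using mult_left_mono[OF ge[of "Suc k"]] by fastforce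
  qed
  also have "\<dots> = expectation (\<lambda>\<omega>. U (?Y \<omega>) + V (?Y \<omega>) * X (Suc k) \<omega> powr s)"
    using indep_var_lebesgue_integral[OF ind intV intX] indep_var_integrable[OF ind intV intX] intU
    by simp
  also have "\<dots> = expectation (\<lambda>\<omega>. stopped_prod a b (\<lambda>l. X l \<omega>) (Suc k) powr s)"
    using nonneg Y_nn
    by (intro Bochner_Integration.integral_cong) (auto simp: U_def V_def powr_mult)
  finally show ?case using Suc.IH by simp
qed

text \<open>The order of choices matters: the level \<open>b\<close> and the time \<open>N\<close>
  come first and make a large stopped value improbable, and only then is \<open>s\<close> taken so
  small that the cap \<open>K\<close> contributes little.\<close>

lemma (in prob_space) ex_powr_moment_less_1:
  fixes X :: "nat \<Rightarrow> 'a \<Rightarrow> real"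
  assumes indep: "indep_vars (\<lambda>_. borel) X {1..}"
    and nonneg: "\<And>l \<omega>. 1 \<le> l \<Longrightarrow> 0 \<le> X l \<omega>"
    and bdd: "\<And>l. 1 \<le> l \<Longrightarrow> AE \<omega> in M. X l \<omega> \<le> C"
    and conv: "AE \<omega> in M. (\<lambda>k. \<Prod>l=1..k. X l \<omega>) \<longlonglongrightarrow> 0"
  shows "\<exists>s>0. \<exists>l\<ge>1. expectation (\<lambda>\<omega>. X l \<omega> powr s) < 1"
proof -
  \<comment> \<open>The bound for the overshoot asks for a constant that is at least 1.\<close>
  define D where "D = max C 1"
  have D: "1 \<le> D" by (simp add: D_def)
  have bddD: "AE \<omega> in M. X l \<omega> \<le> D" if "1 \<le> l" for l
    using bdd[OF that] by eventually_elim (simp add: D_def)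
  have [measurable]: "X l \<in> borel_measurable M" if "1 \<le> l" for l
    using indep that by (auto simp: indep_vars_def)
  define W where "W k \<omega> = (\<Prod>l=1..k. X l \<omega>)" for k \<omega>
  have [measurable]: "W k \<in> borel_measurable M" for k
    unfolding W_def[abs_def] by (intro borel_measurable_prod) auto
  have conv: "AE \<omega> in M. (\<lambda>k. W k \<omega>) \<longlonglongrightarrow> 0"
    using conv by (simp add: W_def)

  \<comment> \<open>These events decrease to a null set because convergent sequences are
    bounded.\<close>
  define A where "A n = {\<omega>\<in>space M. \<exists>j. real n \<le> W j \<omega>}" for n
  have "\<exists>n. prob (A n) < 1/6"
  proof (rule ex_prob_decseq_less)
    show "AE \<omega> in M. \<exists>n. \<omega> \<notin> A n"
      using conv
    proof eventually_elim
      case (elim \<omega>)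
      then have "Bseq (\<lambda>k. W k \<omega>)" using convergent_imp_Bseq convergentI by blast
      then obtain K where K: "\<And>k. norm (W k \<omega>) \<le> K" unfolding Bseq_def by blast
      obtain n where "K < real n" using reals_Archimedean2 by blast
      then have "W k \<omega> < real n" for k using K[of k] by auto
      then have "\<omega> \<notin> A n" by (simp add: A_def not_le)
      then show ?case by blast
    qed
    show "decseq A"
      unfolding decseq_def A_def using of_nat_mono[where ?'a = real] by (blast intro: order_trans)
  qed (auto simp: A_def)
  then obtain n where n: "prob (A n) < 1/6" by blast
  \<comment> \<open>Reaching \<open>b\<close> implies the event \<open>A n\<close> because b \<ge>
    n, and b \<ge> 2 yields K > 1, so that ln K is positive.\<close>
  define b where "b = max (real n) 2"
  define K where "K = b * D"
  have b: "2 \<le> b" by (simp add: b_def)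
  then have K: "1 < K" using D mult_mono[of 2 b 1 D] by (simp add: K_def)

  \<comment> \<open>Quantifying over the whole tail makes \<open>E\<close> decreasing in
    \<open>N\<close>.\<close>
  define E where "E N = {\<omega>\<in>space M. \<exists>k\<ge>N. 1 / K < W k \<omega>}" for N
  have "\<exists>N. prob (E N) < 1/6"
  proof (rule ex_prob_decseq_less)
    show "AE \<omega> in M. \<exists>n. \<omega> \<notin> E n"
      using conv
    proof eventually_elim
      case (elim \<omega>)
      then have "\<forall>\<^sub>F k in sequentially. W k \<omega> < 1 / K"
        using K by (intro order_tendstoD) auto
      then show ?case by (force simp: E_def eventually_sequentially not_less)
    qed
  qed (auto simp: E_def decseq_def intro: order_trans)
  then obtain N where N: "prob (E N) < 1/6" by blast

  define Y where "Y \<omega> = stopped_prod (1 / K) b (\<lambda>l. X l \<omega>) N" for \<omega>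
  have [measurable]: "Y \<in> borel_measurable M"
    unfolding Y_def[abs_def] by (intro measurable_stopped_prod) auto
  have Y_nn: "0 \<le> Y \<omega>" for \<omega>
    unfolding Y_def by (intro stopped_prod_nonneg nonneg)
  have "AE \<omega> in M. \<forall>l\<in>{1..}. X l \<omega> \<le> D"
    using bddD by (intro AE_ball_countable') auto
  then have Y_le: "AE \<omega> in M. Y \<omega> \<le> K"
    unfolding Y_def K_def
    by eventually_elim (use b D nonneg in \<open>auto intro!: stopped_prod_le\<close>)
  define Q where "Q = {\<omega>\<in>space M. 1 / K < Y \<omega>}"
  have [measurable]: "Q \<in> events" "A n \<in> events" "E N \<in> events"
    by (auto simp: Q_def A_def E_def)
  have "1 / K < b" using K b by (smt (verit) divide_less_eq_1)
  \<comment> \<open>A value above 1/K has not been stopped below, so it is either the true product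
    at time \<open>N\<close> or comes from a product that reached \<open>b\<close>.\<close>
  have "Q \<subseteq> A n \<union> E N"
  proof
    fix \<omega> assume "\<omega> \<in> Q"
    then have \<omega>: "\<omega> \<in> space M" "1 / K < Y \<omega>" by (auto simp: Q_def)
    then consider "Y \<omega> = W N \<omega>" | j where "b \<le> W j \<omega>"
      using stopped_prod_cases[OF \<open>1 / K < b\<close>, of "\<lambda>l. X l \<omega>" N]
      by (fastforce simp: Y_def W_def)
    then show "\<omega> \<in> A n \<union> E N"
    proof cases
      case 1
      then have "\<omega> \<in> E N" using \<omega> by (auto simp: E_def)
      then show ?thesis by simp
    next
      case 2
      then have "real n \<le> W j \<omega>" by (simp add: b_def)
      then have "\<omega> \<in> A n" using \<omega> by (auto simp: A_def)
      then show ?thesis by simp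
    qed
  qed
  then have "prob Q \<le> prob (A n) + prob (E N)"
    by (meson finite_measure_mono measure_Un_le order_trans sets.Un \<open>A n \<in> events\<close> \<open>E N \<in> events\<close>)
  then have Q: "prob Q < 1/3" using n N by simp

  \<comment> \<open>This solves K^s = 3/2, hence (1/K)^s = 2/3.\<close>
  define s where "s = ln (3/2) / ln K"
  have s: "0 < s" using K by (simp add: s_def)
  have Ks: "K powr s = 3/2" using K by (simp add: s_def powr_def)
  \<comment> \<open>Here 5/6 = 3/2 - 2/3: the right side is 3/2 on \<open>Q\<close> and 2/3 off it.
    With prob Q < 1/3 its mean is below 17/18.\<close>
  have "AE \<omega> in M. Y \<omega> powr s \<le> 2/3 + 5/6 * indicator Q \<omega>"
    using Y_le AE_space
  proof eventually_elim
    case (elim \<omega>)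
    show ?case
    proof (cases "\<omega> \<in> Q")
      case True
      have "Y \<omega> powr s \<le> K powr s" using elim Y_nn s by (intro powr_mono2) auto
      then show ?thesis using True Ks by simp
    next
      case False
      then have "Y \<omega> powr s \<le> (1 / K) powr s"
        using elim Y_nn s by (intro powr_mono2) (auto simp: Q_def)
      also have "\<dots> = 2/3" by (simp add: powr_divide Ks)
      finally show ?thesis using False by simp
    qed
  qed
  then have "expectation (\<lambda>\<omega>. Y \<omega> powr s) \<le> expectation (\<lambda>\<omega>. 2/3 + 5/6 * indicator Q \<omega>)"
    by (intro integral_mono_AE') (auto simp: emeasure_eq_measure intro!: integrable_real_indicator)
  also have "\<dots> = 2/3 + 5/6 * prob Q"
    by (simp add: prob_space integrable_real_indicator emeasure_eq_measure)
  finally have "expectation (\<lambda>\<omega>. Y \<omega> powr s) < 1" using Q by simp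
  then have "\<exists>l\<ge>1. expectation (\<lambda>\<omega>. X l \<omega> powr s) < 1"
    using expectation_stopped_prod_powr_ge_1[OF indep nonneg bddD _ D s, of b "1 / K" N] b
    unfolding Y_def by force
  then show ?thesis using s by blast
qed

section \<open>Moments of products, and almost sure decay from summable moments\<close>

lemma (in prob_space)
  fixes X :: "nat \<Rightarrow> 'a \<Rightarrow> real"
  assumes indep: "indep_vars (\<lambda>_. borel) X {1..}"
    and int: "\<And>l. 1 \<le> l \<Longrightarrow> integrable M (\<lambda>\<omega>. X l \<omega> powr s)"
    and eq: "\<And>l. 1 \<le> l \<Longrightarrow> expectation (\<lambda>\<omega>. X l \<omega> powr s) = \<rho>"
  shows integrable_prod_powr: "integrable M (\<lambda>\<omega>. (\<Prod>l=1..k. X l \<omega>) powr s)"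
    and expectation_prod_powr: "expectation (\<lambda>\<omega>. (\<Prod>l=1..k. X l \<omega>) powr s) = \<rho> ^ k"
proof -
  have powr: "(\<Prod>l=1..k. X l \<omega>) powr s = (\<Prod>l=1..k. X l \<omega> powr s)" for \<omega>
    by (rule prod_powr_distrib)
  have ind: "indep_vars (\<lambda>_. borel) (\<lambda>l \<omega>. X l \<omega> powr s) {1..k}"
    by (rule indep_vars_compose2[OF indep_vars_subset[OF indep]]) auto
  show "integrable M (\<lambda>\<omega>. (\<Prod>l=1..k. X l \<omega>) powr s)"
    unfolding powr using ind int by (intro indep_vars_integrable) auto
  show "expectation (\<lambda>\<omega>. (\<Prod>l=1..k. X l \<omega>) powr s) = \<rho> ^ k"
    unfolding powr using ind int eq by (subst indep_vars_lebesgue_integral) auto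
qed

text \<open>By monotone convergence the series of the s-th powers has finite expectation. It is
  therefore finite almost surely and its terms tend to 0; taking the power 1/s removes the
  exponent.\<close>

lemma (in prob_space) AE_tendsto_0_if_powr_moments_summable:
  fixes W :: "nat \<Rightarrow> 'a \<Rightarrow> real"
  assumes nonneg: "\<And>k \<omega>. 0 \<le> W k \<omega>"
    and int: "\<And>k. integrable M (\<lambda>\<omega>. W k \<omega> powr s)"
    and sum: "summable (\<lambda>k. expectation (\<lambda>\<omega>. W k \<omega> powr s))" and s: "0 < s"
  shows "AE \<omega> in M. (\<lambda>k. W k \<omega>) \<longlonglongrightarrow> 0"
proof -
  have [measurable]: "(\<lambda>\<omega>. W k \<omega> powr s) \<in> borel_measurable M" for k
    using int by auto
  have "(\<integral>\<^sup>+\<omega>. (\<Sum>k. ennreal (W k \<omega> powr s)) \<partial>M) = (\<Sum>k. \<integral>\<^sup>+\<omega>. ennreal (W k \<omega> powr s) \<partial>M)"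
    by (intro nn_integral_suminf) auto
  also have "\<dots> = (\<Sum>k. ennreal (expectation (\<lambda>\<omega>. W k \<omega> powr s)))"
    by (intro suminf_cong nn_integral_eq_integral int) auto
  also have "\<dots> \<noteq> \<infinity>"
    using sum by (subst suminf_ennreal2) (auto intro!: integral_nonneg_AE)
  finally have "AE \<omega> in M. (\<Sum>k. ennreal (W k \<omega> powr s)) \<noteq> \<infinity>"
    by (intro nn_integral_PInf_AE) auto
  then show ?thesis
  proof eventually_elim
    case (elim \<omega>)
    then have "summable (\<lambda>k. W k \<omega> powr s)"
      by (intro summable_suminf_not_top) auto
    then have "(\<lambda>k. W k \<omega> powr s) \<longlonglongrightarrow> 0" by (rule summable_LIMSEQ_zero)
    then have "(\<lambda>k. (W k \<omega> powr s) powr (1 / s)) \<longlonglongrightarrow> 0 powr (1 / s)"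
      using s by (intro tendsto_powr' tendsto_const) auto
    then show ?case using s nonneg by (simp add: powr_powr)
  qed
qed

section \<open>Moments of the stability function\<close>

abbreviation (input) unif01 :: "real measure" where
  "unif01 \<equiv> uniform_measure lborel {0..1}"

text \<open>This is \<open>G s z\<close>, written as an integral over the law of a node so that it
  does not depend on the underlying probability space.\<close>

definition stab_moment :: "nat \<Rightarrow> real \<Rightarrow> complex \<Rightarrow> real" where
  "stab_moment r s z = (\<integral>t. norm (stab_fun r z t) powr s \<partial>unif01)"

text \<open>A crude bound for |f_{r,z}(t)| over |z| \<le> R and t in [0,1], with 1/(r+1)! estimated
  by 1 in the last term. It serves as the dominating constant and as the constant C for the
  factors.\<close>

definition stab_bound :: "nat \<Rightarrow> real \<Rightarrow> real" where
  "stab_bound r R = (\<Sum>j = 0..r + 1. R ^ j / fact j) + R ^ (r + 2)"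

lemma prob_space_unif01: "prob_space unif01"
  by (intro prob_space_uniform_measure) auto

lemma AE_unif01: "AE t in unif01. t \<in> {0..1}"
  by (intro AE_uniform_measureI) auto

lemma measurable_stab_fun [measurable]: "stab_fun r z \<in> borel_measurable borel"
  unfolding stab_fun_def[abs_def] by measurable

lemma norm_stab_fun_le:
  assumes "t \<in> {0..1}" "norm z \<le> R"
  shows "norm (stab_fun r z t) \<le> stab_bound r R"
proof -
  have "norm (\<Sum>j = 0..r + 1. z ^ j / fact j) \<le> (\<Sum>j = 0..r + 1. R ^ j / fact j)"
    using assms by (intro sum_norm_le) (auto simp: norm_divide norm_power intro!: divide_right_mono power_mono)
  moreover have "norm (complex_of_real (t ^ (r + 1) / fact (r + 1)) * z ^ (r + 2)) \<le> 1 * R ^ (r + 2)"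
    unfolding norm_mult norm_power norm_of_real
  proof (intro mult_mono power_mono)
    have "t ^ (r + 1) \<le> 1" using assms by (intro power_le_one) auto
    also have "(1::real) \<le> fact (r + 1)" by (rule fact_ge_1)
    finally show "\<bar>t ^ (r + 1) / fact (r + 1)\<bar> \<le> 1" using assms by (simp del: fact_Suc)
  qed (use assms in auto)
  ultimately show ?thesis
    unfolding stab_fun_def stab_bound_def by (intro norm_triangle_mono) simp_all
qed

text \<open>A convergent sequence stays in one disc of radius \<open>R\<close>, where
  \<open>stab_bound\<close> gives a dominating constant.\<close>

lemma continuous_stab_moment:
  assumes s: "0 < s"
  shows "continuous_on UNIV (stab_moment r s)"
proof (rule continuous_on_sequentiallyI)
  fix u :: "nat \<Rightarrow> complex" and z
  assume u: "u \<longlonglongrightarrow> z"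
  then have "Bseq u" using convergentI convergent_imp_Bseq by blast
  then obtain R where R: "\<And>n. norm (u n) \<le> R" unfolding Bseq_def by blast
  interpret U: prob_space unif01 by (rule prob_space_unif01)
  show "(\<lambda>n. stab_moment r s (u n)) \<longlonglongrightarrow> stab_moment r s z"
    unfolding stab_moment_def
  proof (rule integral_dominated_convergence)
    \<comment> \<open>At zeros of the stability function the continuity of \<open>powr\<close> at
      base 0 relies on s > 0.\<close>
    show "AE t in unif01. (\<lambda>n. norm (stab_fun r (u n) t) powr s) \<longlonglongrightarrow> norm (stab_fun r z t) powr s"
      unfolding stab_fun_def using u s
      by (intro AE_I2 tendsto_powr' tendsto_norm tendsto_intros) auto
    show "AE t in unif01. norm (norm (stab_fun r (u n) t) powr s) \<le> stab_bound r R powr s" for n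
      using AE_unif01 by eventually_elim (use s R in \<open>auto intro!: powr_mono2 norm_stab_fun_le\<close>)
  qed auto
qed

text \<open>For real t the coefficients of the polynomial in z are real.\<close>

lemma norm_stab_fun_cnj: "norm (stab_fun r (cnj z) t) = norm (stab_fun r z t)"
proof -
  have "stab_fun r (cnj z) t = cnj (stab_fun r z t)" by (simp add: stab_fun_def)
  then show ?thesis by simp
qed

section \<open>Conjugation symmetry and the reference set\<close>

text \<open>One inclusion suffices because conjugation is an involution.\<close>

lemma cnj_image_eqI:
  assumes "\<And>z. z \<in> S \<Longrightarrow> cnj z \<in> S"
  shows "cnj ` S = S"
  using assms by (force intro: image_eqI[where x = "cnj _"])

lemma region_ref_open: "open (region_ref r)"
  unfolding region_ref_def by (intro open_Collect_less continuous_intros) auto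

lemma region_ref_cnj: "cnj ` region_ref r = region_ref r"
proof (rule cnj_image_eqI)
  fix z assume "z \<in> region_ref r"
  moreover have "(\<Sum>j = 0..r + 2. cnj z ^ j / fact j) = cnj (\<Sum>j = 0..r + 2. z ^ j / fact j)"
    by simp
  ultimately show "cnj z \<in> region_ref r" unfolding region_ref_def by (metis complex_mod_cnj mem_Collect_eq)
qed

section \<open>Both stability regions as sublevel sets of moments\<close>

locale uniform_nodes = prob_space M for M :: "'a measure" +
  fixes \<tau> :: "nat \<Rightarrow> 'a \<Rightarrow> real"
  assumes indep: "indep_vars (\<lambda>_. borel) \<tau> {1..}"
    and distr: "\<And>k. k \<ge> 1 \<Longrightarrow> distr M borel (\<tau> k) = unif01"
begin

lemma measurable_node [measurable]: "1 \<le> l \<Longrightarrow> \<tau> l \<in> borel_measurable M"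
  using indep by (auto simp: indep_vars_def)

lemma indep_norm_stab_fun: "indep_vars (\<lambda>_. borel) (\<lambda>l \<omega>. norm (stab_fun r z (\<tau> l \<omega>))) {1..}"
  by (rule indep_vars_compose2[OF indep]) auto

text \<open>The law of a node confines it to [0,1] only up to a null set, so the bound is an almost
  sure one.\<close>

lemma norm_stab_fun_node_le:
  assumes "1 \<le> l"
  shows "AE \<omega> in M. norm (stab_fun r z (\<tau> l \<omega>)) \<le> stab_bound r (norm z)"
proof -
  have "AE t in distr M borel (\<tau> l). norm (stab_fun r z t) \<le> stab_bound r (norm z)"
    unfolding distr[OF assms] using AE_unif01 by eventually_elim (auto intro: norm_stab_fun_le)
  then show ?thesis using assms by (subst (asm) AE_distr_iff) auto
qed

lemma integrable_node_moment:
  assumes "1 \<le> l" "0 < s"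
  shows "integrable M (\<lambda>\<omega>. norm (stab_fun r z (\<tau> l \<omega>)) powr s)"
proof (rule integrable_const_bound)
  show "AE \<omega> in M. norm (norm (stab_fun r z (\<tau> l \<omega>)) powr s) \<le> stab_bound r (norm z) powr s"
    using norm_stab_fun_node_le[OF assms(1)]
    by eventually_elim (use assms in \<open>auto intro!: powr_mono2\<close>)
qed (use assms in auto)

lemma expectation_node_moment:
  assumes "1 \<le> l"
  shows "expectation (\<lambda>\<omega>. norm (stab_fun r z (\<tau> l \<omega>)) powr s) = stab_moment r s z"
  unfolding stab_moment_def distr[OF assms, symmetric]
  using assms by (subst integral_distr) auto

lemma integrable_prod_stab_fun:
  assumes "0 < s"
  shows "integrable M (\<lambda>\<omega>. (\<Prod>l=1..k. norm (stab_fun r z (\<tau> l \<omega>))) powr s)"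
  by (rule integrable_prod_powr[OF indep_norm_stab_fun integrable_node_moment expectation_node_moment])
    (use assms in auto)

lemma expectation_prod_stab_fun:
  assumes "0 < s"
  shows "expectation (\<lambda>\<omega>. (\<Prod>l=1..k. norm (stab_fun r z (\<tau> l \<omega>))) powr s) = stab_moment r s z ^ k"
  by (rule expectation_prod_powr[OF indep_norm_stab_fun integrable_node_moment expectation_node_moment])
    (use assms in auto)

lemma norm_scheme:
  "norm (scheme \<tau> \<eta> r z k \<omega>) = norm \<eta> * (\<Prod>l=1..k. norm (stab_fun r z (\<tau> l \<omega>)))"
  by (simp add: scheme_def norm_mult prod_norm)

text \<open>The exponent may vary with z; this is harmless for openness, which survives arbitrary
  unions.\<close>

lemma region_AS_eq:
  assumes "\<eta> \<noteq> 0"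
  shows "region_AS M \<tau> \<eta> r = (\<Union>s\<in>{0<..}. {z. stab_moment r s z < 1})"
proof -
  have conv: "(\<lambda>k. scheme \<tau> \<eta> r z k \<omega>) \<longlonglongrightarrow> 0 \<longleftrightarrow>
      (\<lambda>k. \<Prod>l=1..k. norm (stab_fun r z (\<tau> l \<omega>))) \<longlonglongrightarrow> 0" for z \<omega>
    using assms tendsto_mult_left_iff[of "norm \<eta>" _ 0 sequentially]
    by (subst tendsto_norm_zero_iff[symmetric]) (simp add: norm_scheme)
  have "(AE \<omega> in M. (\<lambda>k. \<Prod>l=1..k. norm (stab_fun r z (\<tau> l \<omega>))) \<longlonglongrightarrow> 0) \<longleftrightarrow>
      (\<exists>s>0. stab_moment r s z < 1)" (is "?L \<longleftrightarrow> ?R") for z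
  proof
    assume ?L
    then have "\<exists>s>0. \<exists>l\<ge>1. expectation (\<lambda>\<omega>. norm (stab_fun r z (\<tau> l \<omega>)) powr s) < 1"
      by (intro ex_powr_moment_less_1[OF indep_norm_stab_fun _ norm_stab_fun_node_le]) auto
    then show ?R by (auto simp: expectation_node_moment)
  next
    assume ?R
    then obtain s where s: "0 < s" "stab_moment r s z < 1" by blast
    \<comment> \<open>Being nonnegative and below 1, the moment is the ratio of a convergent
      geometric series.\<close>
    have "0 \<le> stab_moment r s z" unfolding stab_moment_def by (intro integral_nonneg_AE) auto
    then show ?L
      using s integrable_prod_stab_fun[OF s(1)]
      by (intro AE_tendsto_0_if_powr_moments_summable[OF _ _ _ s(1)])
        (simp_all only: expectation_prod_stab_fun[OF s(1)] summable_geometric real_norm_def abs_of_nonneg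
          prod_nonneg norm_ge_zero)
  qed
  then show ?thesis by (auto simp: region_AS_def conv)
qed

text \<open>Almost surely bounded factors make every iterate square integrable, so only the limit of
  |\<eta>|^2 * (G 2 z)^k decides.\<close>

lemma region_MS_eq:
  assumes "\<eta> \<noteq> 0"
  shows "region_MS M \<tau> \<eta> r = {z. stab_moment r 2 z < 1}"
proof -
  have "tendsto_L2 M (scheme \<tau> \<eta> r z) (\<lambda>_. 0) \<longleftrightarrow> stab_moment r 2 z < 1" for z
  proof -
    let ?\<rho> = "stab_moment r 2 z"
    have \<rho>: "0 \<le> ?\<rho>" unfolding stab_moment_def by (intro integral_nonneg_AE) auto
    have sq: "(norm (scheme \<tau> \<eta> r z k \<omega>))\<^sup>2 =
        (norm \<eta>)\<^sup>2 * (\<Prod>l=1..k. norm (stab_fun r z (\<tau> l \<omega>))) powr 2" for k \<omega>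
      by (simp add: norm_scheme power_mult_distrib prod_nonneg)
    have int: "integrable M (\<lambda>\<omega>. (norm (scheme \<tau> \<eta> r z k \<omega>))\<^sup>2)" for k
      unfolding sq
      by (intro integrable_mult_right integrable_prod_stab_fun) simp
    have eq: "expectation (\<lambda>\<omega>. (norm (scheme \<tau> \<eta> r z k \<omega>))\<^sup>2) = (norm \<eta>)\<^sup>2 * ?\<rho> ^ k" for k
      unfolding sq integral_mult_right_zero
      by (subst expectation_prod_stab_fun) simp_all
    have "scheme \<tau> \<eta> r z k \<in> borel_measurable M" for k
      unfolding scheme_def[abs_def] by (intro borel_measurable_times borel_measurable_prod) auto
    then have "tendsto_L2 M (scheme \<tau> \<eta> r z) (\<lambda>_. 0) \<longleftrightarrow>
        (\<lambda>k. sqrt ((norm \<eta>)\<^sup>2 * ?\<rho> ^ k)) \<longlonglongrightarrow> 0"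
      using int by (simp add: tendsto_L2_def square_integrable_def eq)
    also have "\<dots> \<longleftrightarrow> (\<lambda>k. sqrt ?\<rho> ^ k) \<longlonglongrightarrow> 0"
      using assms tendsto_mult_left_iff[of "norm \<eta>" _ 0 sequentially]
      by (simp add: real_sqrt_mult real_sqrt_power)
    also have "\<dots> \<longleftrightarrow> ?\<rho> < 1"
    proof
      assume *: "(\<lambda>k. sqrt ?\<rho> ^ k) \<longlonglongrightarrow> 0"
      show "?\<rho> < 1"
      proof (rule ccontr)
        assume "\<not> ?\<rho> < 1"
        then have "1 \<le> sqrt ?\<rho> ^ k" for k by (intro one_le_power) simp
        then show False using LIMSEQ_le_const[OF *, of 1] by auto
      qed
    next
      assume "?\<rho> < 1"
      then show "(\<lambda>k. sqrt ?\<rho> ^ k) \<longlonglongrightarrow> 0" using \<rho> by (intro LIMSEQ_power_zero) simp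
    qed
    finally show ?thesis .
  qed
  then show ?thesis by (simp add: region_MS_def)
qed

end

section \<open>Openness and symmetry of the three regions\<close>

theorem theorem1:
  fixes M :: "'a measure"
    and \<tau> :: "nat \<Rightarrow> 'a \<Rightarrow> real"
    and \<eta> :: complex
    and r :: nat
  assumes "prob_space M"
    and "prob_space.indep_vars M (\<lambda>_. borel) \<tau> {1..}"
    and "\<And>k. k \<ge> 1 \<Longrightarrow> distr M borel (\<tau> k) = uniform_measure lborel {0..1}"
    and "\<eta> \<noteq> 0"
  shows "open (region_MS M \<tau> \<eta> r) \<and> cnj ` region_MS M \<tau> \<eta> r = region_MS M \<tau> \<eta> r \<and>
         open (region_AS M \<tau> \<eta> r) \<and> cnj ` region_AS M \<tau> \<eta> r = region_AS M \<tau> \<eta> r \<and>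
         open (region_ref r) \<and> cnj ` region_ref r = region_ref r"
proof -
  interpret uniform_nodes M \<tau>
    using assms by (intro uniform_nodes.intro uniform_nodes_axioms.intro)
  \<comment> \<open>This covers both stability regions: s = 2 for the mean-square one, the union
    over all s > 0 for the asymptotic one.\<close>
  have "open {z. stab_moment r s z < 1}" if "0 < s" for s
    using continuous_stab_moment[OF that] by (intro open_Collect_less continuous_on_const) auto
  moreover have "stab_moment r s (cnj z) = stab_moment r s z" for s z
    by (simp add: stab_moment_def norm_stab_fun_cnj)
  ultimately show ?thesis
    unfolding region_MS_eq[OF assms(4)] region_AS_eq[OF assms(4)]
    by (intro conjI cnj_image_eqI region_ref_open region_ref_cnj) auto
qed

end
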